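(* Let $\Phi$ be a root system of type $A_\ell$, $j\in J\setminus\{0\}=\{1,\dots,\ell\}$, $\omega=\omega_j$ and $g=\gcd\{\ell+1,j\}$. Then the set $\Phi_{\omega,0}^+=\{\beta\in\Phi^+:\beta^\omega=0\}$ is $$\Phi_{\omega,0}^+=\{e_{p_1}-e_{p_2}: p_1,p_2\in\{1,\dots,\ell+1\},\ p_2-p_1\in g\mathbb{Z}_{>0}\}=\{\alpha_{i_1}+\cdots+\alpha_{i_2}: i_1,i_2\in\{1,\dots,\ell\},\ i_2-i_1+1\in g\mathbb{Z}_{>0}\}.$$ Hence $P(0)=\{\pm1,\dots,\pm(o(\omega)-1)\}$, where $o(\omega)$ is the order of $\omega$.
   Context: Realize $\Phi$ of type $A_\ell$ as $\{e_p-e_q:p\ne q\}$ with $e_1,\dots,e_{\ell+1}$ the standard basis of $\mathbb{R}^{\ell+1}$, in the space $E$ of vectors with coordinate sum $0$; basis $\Delta$: $\alpha_i=e_i-e_{i+1}$ ($1\le i\le\ell$); $\Phi^+=\{e_p-e_q:p<q\}$. The highest root is $\tilde\alpha=\alpha_1+\cdots+\alpha_\ell=\sum n_i\alpha_i$; $\alpha_0=-\tilde\alpha$, $n_0=1$, $J=\{i\in\{0,\dots,\ell\}:n_i=1\}=\{0,\dots,\ell\}$. For $j\in J$ let $w_j$ be the longest element of the subgroup of the Weyl group $W$ generated by the $s_{\alpha_i}$, $i\in\{1,\dots,\ell\}\setminus\{j\}$ (so $w_0$ is the longest element of $W$), and $\omega_j=w_jw_0$; it satisfies $\omega_j(\alpha_i)=\alpha_{\sigma_j(i)}$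 for $i\in\{0,\dots,\ell\}$ with $\sigma_j=(0\ 1\ \cdots\ \ell)^j$. For $\omega=\omega_j$ put $x^\omega=\frac1{o(\omega)}\sum_{t=1}^{o(\omega)}\omega^t(x)$. Let $S_0^j$ be the $\langle\sigma_j\rangle$-orbit of $0$, $\varpi_1^\vee,\dots,\varpi_\ell^\vee\in E$ the dual basis of $\Delta$, $\varpi_0^\vee=0$, and $\pi_0^j=\sum_{s\in S_0^j}\varpi_s^\vee$. For $\beta\in\Phi$ (or for the zero vector in place of $\beta^\omega$) put $P(\beta^\omega)=\{(\gamma,\pi_0^j):\gamma\in\Phi,\ \gamma^\omega=\beta^\omega\}$; in particular $P(0)=\{(\gamma,\pi_0^j):\gamma\in\Phi,\ \gamma^\omega=0\}$. *)

theory Defs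
  imports
    "HOL-Analysis.Finite_Function_Topology"
    "HOL-Algebra.Algebra"
    "HOL-Combinatorics.Combinatorics"
begin

text \<open>
  \<open>\<real>\<close>^(l+1) is taken inside the real vector space of finitely supported functions
  \<open>nat \<Rightarrow>\<^sub>0 real\<close>, as the vectors supported on \<open>{1..l+1}\<close>; this allows the rank l to be
  an ordinary natural number.
\<close>

type_synonym vec = "nat \<Rightarrow>\<^sub>0 real"

definition e :: "nat \<Rightarrow> vec" where
  "e p = Poly_Mapping.single p 1"

definition ip :: "vec \<Rightarrow> vec \<Rightarrow> real" where
  "ip v w = (\<Sum>p\<in>Poly_Mapping.keys v. Poly_Mapping.lookup v p * Poly_Mapping.lookup w p)"

definition E :: "nat \<Rightarrow> vec set" where
  "E l = {v. Poly_Mapping.keys v \<subseteq> {1..l+1} \<and> (\<Sum>p=1..l+1. Poly_Mapping.lookup v p) = 0}"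

definition roots :: "nat \<Rightarrow> vec set" where
  "roots l = {e p - e q | p q. p \<in> {1..l+1} \<and> q \<in> {1..l+1} \<and> p \<noteq> q}"

definition pos_roots :: "nat \<Rightarrow> vec set" where
  "pos_roots l = {e p - e q | p q. p \<in> {1..l+1} \<and> q \<in> {1..l+1} \<and> p < q}"

text \<open>Meant for \<open>i \<in> {1..l}\<close> only; \<open>simple_root 0\<close> is not the affine root \<open>-highest_root l\<close>.\<close>

definition simple_root :: "nat \<Rightarrow> vec" where
  "simple_root i = e i - e (i+1)"

definition highest_root :: "nat \<Rightarrow> vec" where
  "highest_root l = (\<Sum>i=1..l. simple_root i)"

definition mark :: "nat \<Rightarrow> nat \<Rightarrow> real" where
  "mark l i = (if i = 0 then 1
     else representation (simple_root ` {1..l}) (highest_root l) (simple_root i))"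

definition J :: "nat \<Rightarrow> nat set" where
  "J l = {i\<in>{0..l}. mark l i = 1}"

text \<open>
  The reflections are restricted to E (they are \<open>undefined\<close> outside), so that the Weyl group
  is a subgroup of the library's permutation group \<open>BijGroup (E l)\<close>; its product \<open>f \<otimes> g\<close> is
  \<open>f\<close> after \<open>g\<close>.
\<close>

definition reflection :: "nat \<Rightarrow> vec \<Rightarrow> vec \<Rightarrow> vec" where
  "reflection l a = (\<lambda>v\<in>E l. v - (2 * ip v a / ip a a) *\<^sub>R a)"

definition W :: "nat \<Rightarrow> (vec \<Rightarrow> vec) monoid" where
  "W l = (BijGroup (E l)) \<lparr>carrier := generate (BijGroup (E l)) (reflection l ` roots l)\<rparr>"

text \<open>Coxeter length with respect to the simple reflections.\<close>

definition weyl_length :: "nat \<Rightarrow> (vec \<Rightarrow> vec) \<Rightarrow> nat" where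
  "weyl_length l w = (LEAST n. \<exists>is. length is = n \<and> set is \<subseteq> {1..l} \<and>
     w = foldr (\<lambda>i u. reflection l (simple_root i) \<otimes>\<^bsub>W l\<^esub> u) is \<one>\<^bsub>W l\<^esub>)"

definition parabolic :: "nat \<Rightarrow> nat \<Rightarrow> (vec \<Rightarrow> vec) set" where
  "parabolic l j = generate (W l) ((\<lambda>i. reflection l (simple_root i)) ` ({1..l} - {j}))"

definition longest :: "nat \<Rightarrow> nat \<Rightarrow> (vec \<Rightarrow> vec)" where
  "longest l j = (THE w. w \<in> parabolic l j \<and>
     (\<forall>u\<in>parabolic l j. weyl_length l u \<le> weyl_length l w))"

definition omega :: "nat \<Rightarrow> nat \<Rightarrow> (vec \<Rightarrow> vec)" where
  "omega l j = longest l j \<otimes>\<^bsub>W l\<^esub> longest l 0"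

definition average :: "nat \<Rightarrow> (vec \<Rightarrow> vec) \<Rightarrow> vec \<Rightarrow> vec" where
  "average l w x = (1 / real (group.ord (W l) w)) *\<^sub>R
     (\<Sum>t=1..group.ord (W l) w. (w [^]\<^bsub>W l\<^esub> t) x)"

text \<open>\<open>cycle_of_list [0..<l+1]\<close> is the cycle sending each \<open>i < l\<close> to \<open>i+1\<close> and \<open>l\<close> to \<open>0\<close>.\<close>

definition sigma :: "nat \<Rightarrow> nat \<Rightarrow> nat \<Rightarrow> nat" where
  "sigma l j = cycle_of_list [0..<l+1] ^^ j"

definition coweight :: "nat \<Rightarrow> nat \<Rightarrow> vec" where
  "coweight l i = (if i = 0 then 0
     else (THE v. v \<in> E l \<and> (\<forall>k\<in>{1..l}. ip v (simple_root k) = (if k = i then 1 else 0))))"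

definition pi0 :: "nat \<Rightarrow> nat \<Rightarrow> vec" where
  "pi0 l j = (\<Sum>s\<in>orbit (sigma l j) 0. coweight l s)"

definition P :: "nat \<Rightarrow> nat \<Rightarrow> vec \<Rightarrow> real set" where
  "P l j v = {ip \<gamma> (pi0 l j) | \<gamma>. \<gamma> \<in> roots l \<and> average l (omega l j) \<gamma> = v}"

end

theory Submission
  imports Defs
begin

text \<open>
  Write \<open>n = l + 1\<close>. The Weyl group is the symmetric group on \<open>n\<close> letters permuting the
  coordinates, and in this picture everything becomes arithmetic modulo \<open>n\<close>.

  Coxeter length is the number of inversions (\<open>weyl_length_eq\<close>), and the parabolic subgroup
  that omits the simple reflection \<open>j\<close> consists of the permutations preserving the block \<open>{1..j}\<close>
  (\<open>parabolic_eq\<close>). The permutation in it with most inversions reverses each of the two blocks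
  \<open>{1..j}\<close> and \<open>{j+1..n}\<close> (\<open>longest_eq\<close>). Reversing everything and then both
  blocks moves each coordinate cyclically by \<open>j\<close> places; so \<open>\<omega>\<close> is the \<open>j\<close>-th power of an
  \<open>n\<close>-cycle (\<open>omega_eq\<close>). With \<open>g = gcd n j\<close>, its order is \<open>n / g\<close> and its cycles are the
  residue classes modulo \<open>g\<close> in \<open>{1..n}\<close> (\<open>bij_betw_shift_residue_class\<close>).

  Averaging \<open>e p\<close> over the powers of \<open>\<omega>\<close> therefore gives the normalised indicator of the residue
  class of \<open>p\<close>, whence the average of \<open>e p - e q\<close> vanishes exactly when \<open>g\<close> divides \<open>q - p\<close>
  (\<open>average_root_eq_0_iff\<close>). The description by sums of simple roots is the same by telescoping.

  The orbit of \<open>0\<close> under \<open>\<sigma>\<^sub>j\<close> is the set of multiples of \<open>g\<close> in \<open>{0..l}\<close>. For \<open>p < q\<close> the root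
  \<open>e p - e q\<close> pairs to \<open>1\<close> with the coweight of index \<open>s\<close> if \<open>p \<le> s < q\<close> and to \<open>0\<close> otherwise;
  so its pairing with the sum over the orbit counts the multiples of \<open>g\<close> in \<open>{p..<q}\<close>, which for
  \<open>q = p + g m\<close> are \<open>m\<close> in number (\<open>ip_root_pi0\<close>). Here \<open>m\<close> takes every value from \<open>1\<close> to
  \<open>n / g - 1\<close>.
\<close>

section \<open>Vectors and roots\<close>

lemma lookup_e: "Poly_Mapping.lookup (e p) q = (if q = p then 1 else 0)"
  by (simp add: e_def lookup_single when_def)

lemma lookup_scaleR:
  fixes x :: vec
  shows "Poly_Mapping.lookup (r *\<^sub>R x) i = r * Poly_Mapping.lookup x i"
proof -
  have "finite {i. r *\<^sub>R Poly_Mapping.lookup x i \<noteq> 0}"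
    by (rule finite_subset[OF _ finite_keys[of x]]) (auto simp: in_keys_iff)
  then show ?thesis
    by (simp add: scaleR_poly_mapping_def)
qed

lemmas lookup_simps = lookup_e lookup_scaleR lookup_add lookup_minus lookup_sum

lemma ip_eq_sum:
  assumes "finite A" "Poly_Mapping.keys v \<subseteq> A"
  shows "ip v w = (\<Sum>p\<in>A. Poly_Mapping.lookup v p * Poly_Mapping.lookup w p)"
  unfolding ip_def using assms by (intro sum.mono_neutral_left) (auto simp: in_keys_iff)

lemma ip_root_left:
  assumes "p \<noteq> q"
  shows "ip (e p - e q) w = Poly_Mapping.lookup w p - Poly_Mapping.lookup w q"
proof -
  have "ip (e p - e q) w = (\<Sum>k\<in>{p,q}. Poly_Mapping.lookup (e p - e q) k * Poly_Mapping.lookup w k)"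
    by (rule ip_eq_sum) (auto simp: in_keys_iff lookup_simps split: if_splits)
  then show ?thesis
    using assms by (simp add: lookup_simps)
qed

lemma ip_root_right:
  assumes "p \<noteq> q"
  shows "ip v (e p - e q) = Poly_Mapping.lookup v p - Poly_Mapping.lookup v q"
proof -
  have "ip v (e p - e q) = (\<Sum>k\<in>Poly_Mapping.keys v \<union> {p,q}.
      Poly_Mapping.lookup v k * Poly_Mapping.lookup (e p - e q) k)"
    by (rule ip_eq_sum) auto
  also have "\<dots> = (\<Sum>k\<in>{p,q}. Poly_Mapping.lookup v k * Poly_Mapping.lookup (e p - e q) k)"
    by (rule sum.mono_neutral_right) (auto simp: lookup_simps)
  finally show ?thesis
    using assms by (simp add: lookup_simps)
qed

lemma in_E_iff:
  "v \<in> E l \<longleftrightarrow> (\<forall>k. k \<notin> {1..l+1} \<longrightarrow> Poly_Mapping.lookup v k = 0) \<and>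
     (\<Sum>p=1..l+1. Poly_Mapping.lookup v p) = 0"
  unfolding E_def by (auto simp: in_keys_iff subset_iff simp del: sum.cl_ivl_Suc)

lemma root_in_E:
  assumes "p \<in> {1..l+1}" "q \<in> {1..l+1}"
  shows "e p - e q \<in> E l"
proof -
  have "(\<Sum>k=1..l+1. Poly_Mapping.lookup (e p - e q) k)
      = (\<Sum>k=1..l+1. if k = p then 1 else 0) - (\<Sum>k=1..l+1. if k = q then 1 else (0::real))"
    by (simp add: lookup_simps sum_subtractf del: sum.cl_ivl_Suc)
  also have "\<dots> = 0"
    using assms by (simp only: sum.delta finite_atLeastAtMost)
  finally show ?thesis
    using assms by (auto simp: in_E_iff lookup_simps simp del: sum.cl_ivl_Suc)
qed

lemma root_eq_iff:
  assumes "p \<noteq> q"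
  shows "e p - e q = e p' - e q' \<longleftrightarrow> p = p' \<and> q = q'"
proof
  assume eq: "e p - e q = e p' - e q'"
  have "Poly_Mapping.lookup (e p - e q) k = Poly_Mapping.lookup (e p' - e q') k" for k
    by (simp add: eq)
  from this[of p] this[of q] show "p = p' \<and> q = q'"
    using assms by (auto simp: lookup_simps split: if_splits)
qed auto

lemma sum_simple_root:
  assumes "i1 \<le> Suc i2"
  shows "(\<Sum>i=i1..i2. simple_root i) = e i1 - e (Suc i2)"
  using sum_Suc_diff[OF assms, of "\<lambda>i. - e i"] by (simp add: simple_root_def)

lemma simple_root_inj: "inj_on simple_root A"
  by (auto simp: inj_on_def simple_root_def root_eq_iff)

text \<open>On vectors of coordinate sum zero, adding up the first \<open>i\<close> coordinates is pairing with the
  fundamental coweight of index \<open>i\<close>; so this functional reads off coefficients with respect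
  to the simple roots.\<close>

lemma partial_sum_simple_root:
  assumes "1 \<le> k"
  shows "(\<Sum>p=1..i. Poly_Mapping.lookup (simple_root k) p) = (if k = i then 1 else 0)"
proof -
  have "(\<Sum>p=1..i. Poly_Mapping.lookup (simple_root k) p)
      = (\<Sum>p=1..i. if p = k then 1 else 0) - (\<Sum>p=1..i. if p = k + 1 then 1 else (0::real))"
    by (simp add: simple_root_def lookup_simps sum_subtractf)
  then show ?thesis
    using assms by (auto simp: sum.delta)
qed

lemma independent_simple_roots: "independent (simple_root ` {1..l})"
  unfolding dependent_finite[OF finite_imageI[OF finite_atLeastAtMost]]
proof (safe)
  fix u i
  assume zero: "(\<Sum>v\<in>simple_root ` {1..l}. u v *\<^sub>R v) = 0" and i: "i \<in> {1..l}"
    and ne: "u (simple_root i) \<noteq> 0"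
  have "0 = (\<Sum>p=1..i. Poly_Mapping.lookup (\<Sum>k=1..l. u (simple_root k) *\<^sub>R simple_root k) p)"
    using zero by (simp add: sum.reindex[OF simple_root_inj])
  also have "\<dots> = (\<Sum>k=1..l. u (simple_root k) * (\<Sum>p=1..i. Poly_Mapping.lookup (simple_root k) p))"
    by (subst sum_distrib_left, subst sum.swap) (simp add: lookup_simps)
  also have "\<dots> = (\<Sum>k=1..l. if k = i then u (simple_root k) else 0)"
    by (intro sum.cong) (auto simp: partial_sum_simple_root simp del: One_nat_def)
  also have "\<dots> = u (simple_root i)"
    using i by (simp only: sum.delta finite_atLeastAtMost) simp
  finally show False
    using ne by simp
qed

text \<open>The highest root is by definition the sum of the simple roots, and independence makes the
  coefficients in that sum its coordinates.\<close>

lemma mark_eq_1: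
  assumes "i \<in> {0..l}"
  shows "mark l i = 1"
proof (cases "i = 0")
  case False
  let ?B = "simple_root ` {1..l}"
  let ?f = "\<lambda>b. if b \<in> ?B then 1 else (0::real)"
  have "representation ?B (highest_root l) = ?f"
  proof (rule real_vector.representation_eqI[OF independent_simple_roots])
    show "highest_root l \<in> span ?B"
      unfolding highest_root_def by (intro span_sum span_base) auto
    have "{b. ?f b \<noteq> 0} = ?B"
      by auto
    then show "finite {b. ?f b \<noteq> 0}" "(\<Sum>b | ?f b \<noteq> 0. ?f b *\<^sub>R b) = highest_root l"
      by (simp_all add: highest_root_def sum.reindex[OF simple_root_inj])
  qed (auto split: if_splits)
  then show ?thesis
    using False assms by (simp add: mark_def)
qed (simp add: mark_def)

lemma J_eq: "J l = {0..l}"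
  by (auto simp: J_def mark_eq_1)

text \<open>The orthogonal projection of \<open>e 1 + \<dots> + e i\<close> to the hyperplane of coordinate sum zero.\<close>

definition fundamental_coweight :: "nat \<Rightarrow> nat \<Rightarrow> vec" where
  "fundamental_coweight l i = (\<Sum>p=1..i. e p) - (real i / real (l+1)) *\<^sub>R (\<Sum>p=1..l+1. e p)"

lemma lookup_fundamental_coweight:
  assumes "i \<le> l"
  shows "Poly_Mapping.lookup (fundamental_coweight l i) p =
    (if p \<in> {1..i} then 1 else 0) - (if p \<in> {1..l+1} then real i / real (l+1) else 0)"
  using assms by (simp add: fundamental_coweight_def lookup_simps del: sum.cl_ivl_Suc)

text \<open>A vector of \<open>E l\<close> is determined by its pairings with the simple roots: these
  are the consecutive differences of its coordinates, and the coordinates add up to zero.\<close>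

lemma coweight_eq:
  assumes "i \<in> {1..l}"
  shows "coweight l i = fundamental_coweight l i"
proof -
  let ?c = "fundamental_coweight l i"
  let ?dual = "\<lambda>v. v \<in> E l \<and> (\<forall>k\<in>{1..l}. ip v (simple_root k) = (if k = i then 1 else 0))"
  have "(\<Sum>p=1..l+1. Poly_Mapping.lookup ?c p)
      = (\<Sum>p=1..l+1. if p \<in> {1..i} then 1 else 0) - (\<Sum>p=1..l+1. real i / real (l+1))"
    using assms by (simp add: lookup_fundamental_coweight sum_subtractf del: sum.cl_ivl_Suc)
  also have "(\<Sum>p=1..l+1. if p \<in> {1..i} then 1 else 0) = (\<Sum>p=1..i. 1::real)"
    using assms by (intro sum.mono_neutral_cong_right) auto
  finally have "(\<Sum>p=1..l+1. Poly_Mapping.lookup ?c p) = 0"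
    by (simp del: sum.cl_ivl_Suc)
  then have "?c \<in> E l"
    using assms by (auto simp: in_E_iff lookup_fundamental_coweight simp del: sum.cl_ivl_Suc)
  then have dual: "?dual ?c"
    using assms by (auto simp: simple_root_def ip_root_right lookup_fundamental_coweight)
  have "v = ?c" if v: "?dual v" for v
  proof -
    let ?d = "v - ?c"
    have step: "Poly_Mapping.lookup ?d k = Poly_Mapping.lookup ?d (Suc k)" if "k \<in> {1..l}" for k
    proof -
      have "ip v (simple_root k) = ip ?c (simple_root k)"
        using v dual that by simp
      then have "Poly_Mapping.lookup v k - Poly_Mapping.lookup v (Suc k)
          = Poly_Mapping.lookup ?c k - Poly_Mapping.lookup ?c (Suc k)"
        by (simp add: simple_root_def ip_root_right)
      then show ?thesis
        unfolding lookup_minus by linarith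
    qed
    have const: "Poly_Mapping.lookup ?d k = Poly_Mapping.lookup ?d 1" if "k \<in> {1..l+1}" for k
      using that
    proof (induction k)
      case (Suc k)
      then show ?case
        using step[of k] by (cases "k = 0") auto
    qed simp
    have "0 = (\<Sum>p=1..l+1. Poly_Mapping.lookup ?d p)"
      using v dual by (simp add: in_E_iff lookup_minus sum_subtractf del: sum.cl_ivl_Suc)
    also have "\<dots> = (\<Sum>p=1..l+1. Poly_Mapping.lookup ?d 1)"
      by (intro sum.cong refl const)
    also have "\<dots> = real (l + 1) * Poly_Mapping.lookup ?d 1"
      by (simp del: sum.cl_ivl_Suc)
    finally have zero: "Poly_Mapping.lookup ?d 1 = 0"
      by simp
    have "Poly_Mapping.lookup ?d k = 0" for k
    proof (cases "k \<in> {1..l+1}")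
      case False
      then show ?thesis
        using v dual by (simp add: in_E_iff lookup_minus)
    qed (use const zero in metis)
    then have "?d = 0"
      by (intro poly_mapping_eqI) simp
    then show ?thesis
      by simp
  qed
  with dual have "(THE v. ?dual v) = ?c"
    by (intro the_equality) blast+
  then show ?thesis
    using assms by (simp add: coweight_def)
qed

text \<open>For \<open>p < q\<close> the root \<open>e p - e q\<close> is the sum of the simple roots with index in \<open>{p..<q}\<close>.
  The convention that the coweight of index \<open>0\<close> vanishes fits the formula because \<open>p \<ge> 1\<close>.\<close>

lemma ip_root_coweight:
  assumes "p \<in> {1..l+1}" "q \<in> {1..l+1}" "p < q" "s \<le> l"
  shows "ip (e p - e q) (coweight l s) = (if s \<in> {p..<q} then 1 else 0)"
proof (cases "s = 0")
  case True
  then show ?thesis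
    using assms by (simp add: coweight_def ip_root_left)
next
  case False
  then show ?thesis
    using assms by (auto simp: coweight_eq ip_root_left lookup_fundamental_coweight)
qed

section \<open>The symmetric group acting on coordinates\<close>

text \<open>Composition with the inverse makes this a left action: the entry at position \<open>p\<close> moves to
  position \<open>\<pi> p\<close>. Restricting to \<open>E l\<close> matches the extensional functions of \<open>BijGroup\<close>.\<close>

definition coord_perm :: "nat \<Rightarrow> (nat \<Rightarrow> nat) \<Rightarrow> vec \<Rightarrow> vec" where
  "coord_perm l \<pi> = (\<lambda>v\<in>E l. Poly_Mapping.map_key (inv_into UNIV \<pi>) v)"

lemma lookup_coord_perm:
  assumes "\<pi> permutes {1..l+1}" "v \<in> E l"
  shows "Poly_Mapping.lookup (coord_perm l \<pi> v) k = Poly_Mapping.lookup v (inv_into UNIV \<pi> k)"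
proof -
  have "inj (inv_into UNIV \<pi>)"
    using permutes_inj[OF permutes_inv[OF assms(1)]] .
  then show ?thesis
    using assms(2) by (simp add: coord_perm_def map_key.rep_eq)
qed

lemma coord_perm_closed:
  assumes "\<pi> permutes {1..l+1}" "v \<in> E l"
  shows "coord_perm l \<pi> v \<in> E l"
proof -
  have inv: "inv_into UNIV \<pi> permutes {1..l+1}"
    using permutes_inv[OF assms(1)] .
  have "(\<Sum>p=1..l+1. Poly_Mapping.lookup v (inv_into UNIV \<pi> p)) = (\<Sum>p=1..l+1. Poly_Mapping.lookup v p)"
    using sum.permute[OF inv, of "Poly_Mapping.lookup v"] by (simp add: o_def)
  then show ?thesis
    using assms(2) permutes_in_image[OF inv] permutes_not_in[OF inv]
    by (simp add: in_E_iff lookup_coord_perm[OF assms] del: sum.cl_ivl_Suc)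
qed

lemma coord_perm_comp:
  assumes "\<pi> permutes {1..l+1}" "\<rho> permutes {1..l+1}" "v \<in> E l"
  shows "coord_perm l \<pi> (coord_perm l \<rho> v) = coord_perm l (\<pi> \<circ> \<rho>) v"
proof (rule poly_mapping_eqI)
  fix k
  have "inv_into UNIV (\<pi> \<circ> \<rho>) = inv_into UNIV \<rho> \<circ> inv_into UNIV \<pi>"
    using permutes_bij assms by (intro o_inv_distrib) auto
  then show "Poly_Mapping.lookup (coord_perm l \<pi> (coord_perm l \<rho> v)) k
      = Poly_Mapping.lookup (coord_perm l (\<pi> \<circ> \<rho>) v) k"
    using assms by (simp add: lookup_coord_perm coord_perm_closed permutes_compose)
qed

lemma coord_perm_id: "coord_perm l id = (\<lambda>v\<in>E l. v)"
  by (rule ext) (auto simp: coord_perm_def id_def Poly_Mapping.map_key_id inv_into_def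
      intro!: poly_mapping_eqI)

lemma coord_perm_Bij:
  assumes "\<pi> permutes {1..l+1}"
  shows "coord_perm l \<pi> \<in> Bij (E l)"
proof -
  have inv: "inv_into UNIV \<pi> permutes {1..l+1}"
    using permutes_inv[OF assms] .
  have "bij_betw (coord_perm l \<pi>) (E l) (E l)"
    by (rule bij_betw_byWitness[where f' = "coord_perm l (inv_into UNIV \<pi>)"])
      (auto simp: coord_perm_comp[OF inv assms] coord_perm_comp[OF assms inv]
        coord_perm_closed[OF assms] coord_perm_closed[OF inv] permutes_inv_o[OF assms] coord_perm_id)
  then show ?thesis
    by (auto simp: Bij_def coord_perm_def)
qed

lemma coord_perm_root:
  assumes "\<pi> permutes {1..l+1}" "p \<in> {1..l+1}" "q \<in> {1..l+1}"
  shows "coord_perm l \<pi> (e p - e q) = e (\<pi> p) - e (\<pi> q)"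
  using permutes_inv_eq[OF assms(1)]
  by (intro poly_mapping_eqI)
    (auto simp: lookup_coord_perm[OF assms(1) root_in_E[OF assms(2,3)]] lookup_simps)

text \<open>A permutation is recovered from its action on the roots \<open>e p - e q\<close>, so each index needs
  a partner different from it: this is where \<open>l \<ge> 1\<close> enters.\<close>

lemma coord_perm_faithful:
  assumes "1 \<le> l" "\<pi> permutes {1..l+1}" "\<rho> permutes {1..l+1}"
    and eq: "coord_perm l \<pi> = coord_perm l \<rho>"
  shows "\<pi> = \<rho>"
proof
  fix p
  show "\<pi> p = \<rho> p"
  proof (cases "p \<in> {1..l+1}")
    case True
    define q where "q = (if p = 1 then 2 else 1::nat)"
    have q: "q \<in> {1..l+1}" "p \<noteq> q"
      using assms(1) by (auto simp: q_def)
    then have "e (\<pi> p) - e (\<pi> q) = e (\<rho> p) - e (\<rho> q)"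
      using True eq coord_perm_root[OF assms(2) True q(1)] coord_perm_root[OF assms(3) True q(1)]
      by simp
    moreover have "\<pi> p \<noteq> \<pi> q"
      using q by (simp add: inj_eq[OF permutes_inj[OF assms(2)]])
    ultimately show ?thesis
      by (simp add: root_eq_iff)
  next
    case False
    then show ?thesis
      using assms(2,3) by (simp add: permutes_not_in)
  qed
qed

lemma reflection_root:
  assumes "p \<in> {1..l+1}" "q \<in> {1..l+1}" "p \<noteq> q"
  shows "reflection l (e p - e q) = coord_perm l (transpose p q)"
proof
  fix v
  have t: "transpose p q permutes {1..l+1}"
    using assms by (simp add: permutes_swap_id)
  show "reflection l (e p - e q) v = coord_perm l (transpose p q) v"
  proof (cases "v \<in> E l")
    case True
    have "ip (e p - e q) (e p - e q) = 2"
      using assms(3) by (simp add: ip_root_left lookup_simps)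
    then have "reflection l (e p - e q) v
        = v - (Poly_Mapping.lookup v p - Poly_Mapping.lookup v q) *\<^sub>R (e p - e q)"
      using True assms(3) by (simp add: reflection_def ip_root_right)
    also have "\<dots> = coord_perm l (transpose p q) v"
      by (rule poly_mapping_eqI)
        (use assms(3) in \<open>auto simp: lookup_coord_perm[OF t True] lookup_simps transpose_def\<close>)
    finally show ?thesis .
  qed (simp add: reflection_def coord_perm_def)
qed

lemma reflection_simple_root:
  assumes "i \<in> {1..l}"
  shows "reflection l (simple_root i) = coord_perm l (transpose i (Suc i))"
  using assms reflection_root[of i l "Suc i"] by (simp add: simple_root_def)

lemma reflections_Bij: "reflection l ` roots l \<subseteq> carrier (BijGroup (E l))"
  by (auto simp: roots_def reflection_root BijGroup_def intro!: coord_perm_Bij permutes_swap_id)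

lemma W_group: "group (W l)"
  unfolding W_def using group.generate_is_subgroup[OF group_BijGroup reflections_Bij]
  by (intro subgroup.subgroup_is_group group_BijGroup)

lemma W_mult:
  assumes "\<pi> permutes {1..l+1}" "\<rho> permutes {1..l+1}"
  shows "coord_perm l \<pi> \<otimes>\<^bsub>W l\<^esub> coord_perm l \<rho> = coord_perm l (\<pi> \<circ> \<rho>)"
proof -
  have "compose (E l) (coord_perm l \<pi>) (coord_perm l \<rho>) = coord_perm l (\<pi> \<circ> \<rho>)"
  proof
    fix v
    show "compose (E l) (coord_perm l \<pi>) (coord_perm l \<rho>) v = coord_perm l (\<pi> \<circ> \<rho>) v"
    proof (cases "v \<in> E l")
      case True
      then show ?thesis
        by (simp add: compose_def coord_perm_comp[OF assms])
    qed (simp add: compose_def coord_perm_def)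
  qed
  then show ?thesis
    using coord_perm_Bij[OF assms(1)] coord_perm_Bij[OF assms(2)] by (simp add: W_def BijGroup_def)
qed

lemma W_one: "\<one>\<^bsub>W l\<^esub> = coord_perm l id"
  by (simp add: W_def BijGroup_def coord_perm_id)

lemma simple_reflection_in_W:
  assumes "i \<in> {1..l}"
  shows "reflection l (simple_root i) \<in> carrier (W l)"
proof -
  have "i \<in> {1..l+1}" "i + 1 \<in> {1..l+1}" "i \<noteq> i + 1"
    using assms by auto
  then have "simple_root i \<in> roots l"
    unfolding simple_root_def roots_def by blast
  then show ?thesis
    by (auto simp: W_def intro: generate.incl)
qed

section \<open>Length and inversions\<close>

definition inversions :: "nat \<Rightarrow> (nat \<Rightarrow> nat) \<Rightarrow> (nat \<times> nat) set" where
  "inversions n \<pi> = {(a, b). a \<in> {1..n} \<and> b \<in> {1..n} \<and> a < b \<and> \<pi> b < \<pi> a}"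

lemma finite_inversions: "finite (inversions n \<pi>)"
  by (rule finite_subset[of _ "{1..n} \<times> {1..n}"]) (auto simp: inversions_def)

lemma inversions_id: "inversions n id = {}"
  by (auto simp: inversions_def)

text \<open>Exchanging two adjacent values changes only the order of those two. Hence multiplication by a
  simple reflection on the left adds or removes exactly one inversion.\<close>

lemma adjacent_transpose_less_iff:
  "transpose i (Suc i) x < transpose i (Suc i) y \<longleftrightarrow>
     x < y \<and> \<not> (x = i \<and> y = Suc i) \<or> x = Suc i \<and> y = i"
  by (auto simp: transpose_def)

lemma inversions_transpose_ascent:
  assumes "\<pi> permutes {1..n}" "i \<in> {1..<n}"
    and "a = inv_into UNIV \<pi> i" "b = inv_into UNIV \<pi> (Suc i)" "a < b"
  shows "inversions n (transpose i (Suc i) \<circ> \<pi>) = insert (a, b) (inversions n \<pi>)"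
    and "(a, b) \<notin> inversions n \<pi>"
proof -
  have [simp]: "\<pi> x = i \<longleftrightarrow> x = a" "\<pi> x = Suc i \<longleftrightarrow> x = b" for x
    using permutes_inv_eq[OF assms(1)] assms(3,4) by metis+
  have ab: "a \<in> {1..n}" "b \<in> {1..n}"
    using permutes_in_image[OF permutes_inv[OF assms(1)]] assms(2-4) by auto
  show "inversions n (transpose i (Suc i) \<circ> \<pi>) = insert (a, b) (inversions n \<pi>)"
    using ab assms(5) by (auto simp: inversions_def adjacent_transpose_less_iff)
  have "\<pi> a = i" "\<pi> b = Suc i"
    by simp_all
  then show "(a, b) \<notin> inversions n \<pi>"
    by (auto simp: inversions_def simp del: \<open>\<And>x. \<pi> x = i \<longleftrightarrow> x = a\<close> \<open>\<And>x. \<pi> x = Suc i \<longleftrightarrow> x = b\<close>)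
qed

lemma permutes_transpose_comp:
  assumes "\<pi> permutes {1..n}" "i \<in> {1..<n}"
  shows "transpose i (Suc i) \<circ> \<pi> permutes {1..n}"
  using assms by (intro permutes_compose permutes_swap_id) auto

text \<open>The descending case is the ascending one read backwards, from the swapped permutation.\<close>

lemma card_inversions_transpose_descent:
  assumes "\<pi> permutes {1..n}" "i \<in> {1..<n}" "inv_into UNIV \<pi> (Suc i) < inv_into UNIV \<pi> i"
  shows "card (inversions n \<pi>) = Suc (card (inversions n (transpose i (Suc i) \<circ> \<pi>)))"
proof -
  let ?\<rho> = "transpose i (Suc i) \<circ> \<pi>"
  have \<rho>: "?\<rho> permutes {1..n}"
    using permutes_transpose_comp assms by blast
  have "inv_into UNIV ?\<rho> i = inv_into UNIV \<pi> (Suc i)" "inv_into UNIV ?\<rho> (Suc i) = inv_into UNIV \<pi> i"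
    using permutes_inverses[OF assms(1)] by (simp_all add: permutes_inv_eq[OF \<rho>])
  moreover have "transpose i (Suc i) \<circ> ?\<rho> = \<pi>"
    by (simp add: fun_eq_iff)
  ultimately show ?thesis
    using inversions_transpose_ascent[OF \<rho> assms(2) refl refl] assms(3)
    by (simp add: finite_inversions)
qed

lemma card_inversions_transpose_le:
  assumes "\<pi> permutes {1..n}" "i \<in> {1..<n}"
  shows "card (inversions n (transpose i (Suc i) \<circ> \<pi>)) \<le> Suc (card (inversions n \<pi>))"
proof (cases "inv_into UNIV \<pi> i < inv_into UNIV \<pi> (Suc i)")
  case True
  then show ?thesis
    using inversions_transpose_ascent[OF assms refl refl] by (simp add: finite_inversions)
next
  case False
  moreover have "inv_into UNIV \<pi> i \<noteq> inv_into UNIV \<pi> (Suc i)"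
    by (simp add: inj_eq[OF permutes_inj[OF permutes_inv[OF assms(1)]]])
  ultimately show ?thesis
    using card_inversions_transpose_descent[OF assms] by simp
qed

text \<open>An increasing permutation satisfies \<open>i \<le> \<sigma> i\<close> throughout, which leaves only the identity.\<close>

lemma permutation_without_descents:
  assumes "\<sigma> permutes {1..n}" and asc: "\<And>i. i \<in> {1..<n} \<Longrightarrow> \<sigma> i < \<sigma> (Suc i)"
  shows "\<sigma> = id"
proof (rule permutes_natset_ge[OF assms(1)], rule ballI)
  fix i
  assume "i \<in> {1..n}"
  then show "i \<le> \<sigma> i"
  proof (induction i)
    case (Suc i)
    then show ?case
      using asc[of i] permutes_in_image[OF assms(1), of "Suc i"] by (cases "i = 0") auto
  qed simp
qed

text \<open>The inversions tell which of any two values is the larger. Two permutations that agree on this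
  differ by an increasing permutation of the values, hence not at all.\<close>

lemma inversions_inj:
  assumes "\<pi> permutes {1..n}" "\<rho> permutes {1..n}" "inversions n \<pi> = inversions n \<rho>"
  shows "\<pi> = \<rho>"
proof -
  let ?\<sigma> = "\<rho> \<circ> inv_into UNIV \<pi>"
  have mono: "\<rho> a < \<rho> b" if "a \<in> {1..n}" "b \<in> {1..n}" "\<pi> a < \<pi> b" for a b
  proof -
    have "(a, b) \<in> inversions n \<pi> \<longleftrightarrow> (a, b) \<in> inversions n \<rho>"
      "(b, a) \<in> inversions n \<pi> \<longleftrightarrow> (b, a) \<in> inversions n \<rho>"
      by (simp_all add: assms(3))
    moreover have "\<rho> a \<noteq> \<rho> b"
      using that by (auto simp: inj_eq[OF permutes_inj[OF assms(2)]])
    ultimately show ?thesis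
      using that by (auto simp: inversions_def)
  qed
  have "?\<sigma> = id"
  proof (rule permutation_without_descents)
    show "?\<sigma> permutes {1..n}"
      using assms by (intro permutes_compose permutes_inv)
    fix i
    assume "i \<in> {1..<n}"
    then show "?\<sigma> i < ?\<sigma> (Suc i)"
      using permutes_in_image[OF permutes_inv[OF assms(1)]] permutes_inverses[OF assms(1)]
      by (auto intro!: mono)
  qed
  then have "?\<sigma> \<circ> \<pi> = \<pi>"
    by simp
  then show ?thesis
    by (simp add: o_assoc[symmetric] permutes_inv_o[OF assms(1)])
qed

definition word_perm :: "nat list \<Rightarrow> nat \<Rightarrow> nat" where
  "word_perm is = foldr (\<lambda>i \<pi>. transpose i (Suc i) \<circ> \<pi>) is id"

lemma word_perm_simps:
  "word_perm [] = id"
  "word_perm (i # is) = transpose i (Suc i) \<circ> word_perm is"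
  by (simp_all add: word_perm_def)

lemma word_perm_permutes: "set is \<subseteq> {1..l} \<Longrightarrow> word_perm is permutes {1..l+1}"
proof (induction "is")
  case Nil
  show ?case
    unfolding word_perm_simps by (rule permutes_id)
next
  case (Cons i "is")
  then show ?case
    unfolding word_perm_simps by (intro permutes_transpose_comp) auto
qed

lemma word_eq_coord_perm:
  assumes "set is \<subseteq> {1..l}"
  shows "foldr (\<lambda>i u. reflection l (simple_root i) \<otimes>\<^bsub>W l\<^esub> u) is \<one>\<^bsub>W l\<^esub> = coord_perm l (word_perm is)"
  using assms
proof (induction "is")
  case (Cons i "is")
  then have "transpose i (Suc i) permutes {1..l+1}" "word_perm is permutes {1..l+1}"
    by (intro permutes_swap_id word_perm_permutes; simp)+
  from W_mult[OF this] Cons show ?case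
    by (simp add: word_perm_simps reflection_simple_root o_def)
qed (simp add: W_one word_perm_simps)

lemma card_inversions_word_perm_le:
  assumes "set is \<subseteq> {1..l}"
  shows "card (inversions (l+1) (word_perm is)) \<le> length is"
  using assms
proof (induction "is")
  case Nil
  then show ?case
    unfolding word_perm_simps inversions_id by simp
next
  case (Cons i "is")
  then have "set is \<subseteq> {1..l}" "i \<in> {1..<l+1}"
    by auto
  then have "card (inversions (l+1) (word_perm (i # is))) \<le> Suc (card (inversions (l+1) (word_perm is)))"
    unfolding word_perm_simps by (intro card_inversions_transpose_le word_perm_permutes)
  then show ?case
    using Cons.IH[OF \<open>set is \<subseteq> {1..l}\<close>] by simp
qed

text \<open>As long as the permutation is not the identity, some values \<open>i\<close> and \<open>i+1\<close> occur in the wrong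
  order, and exchanging them removes one inversion. If the permutation preserves the block
  \<open>{1..j}\<close>, then \<open>j\<close> occurs before \<open>j+1\<close>, so that \<open>i \<noteq> j\<close> and the block stays preserved. The
  same induction thus yields shortest words in the whole group (\<open>j = 0\<close>) and the generation of
  block-preserving permutations by the remaining simple reflections.\<close>

lemma reduced_word:
  assumes "\<pi> permutes {1..l+1}" "\<pi> ` {1..j} \<subseteq> {1..j}" "j \<le> l"
  shows "\<exists>is. set is \<subseteq> {1..l} - {j} \<and> length is = card (inversions (l+1) \<pi>) \<and> word_perm is = \<pi>"
  using assms(1,2)
proof (induction "card (inversions (l+1) \<pi>)" arbitrary: \<pi> rule: less_induct)
  case less
  show ?case
  proof (cases "\<pi> = id")
    case True
    then show ?thesis
      by (intro exI[of _ "[]"]) (simp add: word_perm_simps inversions_id)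
  next
    case False
    let ?inv = "inv_into UNIV \<pi>"
    have inv: "?inv permutes {1..l+1}"
      using permutes_inv[OF less.prems(1)] .
    have "?inv \<noteq> id"
      using False permutes_inv_inv[OF less.prems(1)] by (metis inv_id)
    then obtain i where i: "i \<in> {1..<l+1}" "\<not> ?inv i < ?inv (Suc i)"
      using permutation_without_descents[OF inv] by blast
    moreover have "?inv i \<noteq> ?inv (Suc i)"
      by (simp add: inj_eq[OF permutes_inj[OF inv]])
    ultimately have desc: "?inv (Suc i) < ?inv i"
      by simp
    have block: "\<pi> ` {1..j} = {1..j}"
      using less.prems permutes_inj_on[OF less.prems(1)] by (intro endo_inj_surj) auto
    have "i \<noteq> j"
    proof
      assume "i = j"
      then have "?inv i \<in> {1..j}"
        using block i permutes_inv_eq[OF less.prems(1)]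
        by (metis atLeastAtMost_iff atLeastLessThan_iff imageE order_refl)
      moreover have "?inv (Suc i) \<notin> {1..j}"
      proof
        assume "?inv (Suc i) \<in> {1..j}"
        then have "\<pi> (?inv (Suc i)) \<in> {1..j}"
          using less.prems(2) by blast
        then show False
          using \<open>i = j\<close> permutes_inverses[OF less.prems(1)] by simp
      qed
      moreover have "?inv (Suc i) \<in> {1..l+1}"
        using i permutes_in_image[OF inv, of "Suc i"] by auto
      ultimately show False
        using desc by auto
    qed
    let ?\<rho> = "transpose i (Suc i) \<circ> \<pi>"
    have \<rho>: "?\<rho> permutes {1..l+1}"
      using permutes_transpose_comp[OF less.prems(1) i(1)] .
    have card: "card (inversions (l+1) \<pi>) = Suc (card (inversions (l+1) ?\<rho>))"
      using card_inversions_transpose_descent[OF less.prems(1) i(1) desc] .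
    have "transpose i (Suc i) ` {1..j} \<subseteq> {1..j}"
      using \<open>i \<noteq> j\<close> i by (auto simp: transpose_def)
    then have "?\<rho> ` {1..j} \<subseteq> {1..j}"
      using less.prems(2) by fastforce
    then obtain "is" where "is": "set is \<subseteq> {1..l} - {j}" "length is = card (inversions (l+1) ?\<rho>)"
        "word_perm is = ?\<rho>"
      using less.hyps[of ?\<rho>] \<rho> card by auto
    have "word_perm (i # is) = \<pi>"
      by (simp add: word_perm_simps "is"(3) fun_eq_iff)
    then show ?thesis
      using "is" card i \<open>i \<noteq> j\<close> by (intro exI[of _ "i # is"]) auto
  qed
qed

text \<open>Each letter of a word creates at most one inversion, and a reduced word attains this bound.\<close>

lemma weyl_length_eq:
  assumes "1 \<le> l" "\<pi> permutes {1..l+1}"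
  shows "weyl_length l (coord_perm l \<pi>) = card (inversions (l+1) \<pi>)"
  unfolding weyl_length_def
proof (rule Least_equality)
  obtain "is" where "is": "set is \<subseteq> {1..l}" "length is = card (inversions (l+1) \<pi>)" "word_perm is = \<pi>"
    using reduced_word[OF assms(2), of 0] by auto
  then show "\<exists>is. length is = card (inversions (l+1) \<pi>) \<and> set is \<subseteq> {1..l} \<and>
      coord_perm l \<pi> = foldr (\<lambda>i u. reflection l (simple_root i) \<otimes>\<^bsub>W l\<^esub> u) is \<one>\<^bsub>W l\<^esub>"
    by (metis word_eq_coord_perm)
next
  fix n
  assume "\<exists>is. length is = n \<and> set is \<subseteq> {1..l} \<and>
      coord_perm l \<pi> = foldr (\<lambda>i u. reflection l (simple_root i) \<otimes>\<^bsub>W l\<^esub> u) is \<one>\<^bsub>W l\<^esub>"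
  then obtain "is" where "is": "length is = n" "set is \<subseteq> {1..l}"
      "coord_perm l \<pi> = coord_perm l (word_perm is)"
    by (auto simp: word_eq_coord_perm)
  then have "\<pi> = word_perm is"
    using coord_perm_faithful[OF assms(1,2) word_perm_permutes] by blast
  then show "card (inversions (l+1) \<pi>) \<le> n"
    using card_inversions_word_perm_le "is" by blast
qed

section \<open>Longest elements of parabolic subgroups\<close>

lemma parabolic_eq:
  assumes "j \<le> l"
  shows "parabolic l j = {coord_perm l \<pi> | \<pi>. \<pi> permutes {1..l+1} \<and> \<pi> ` {1..j} \<subseteq> {1..j}}"
    (is "_ = ?B")
proof (intro equalityI subsetI)
  let ?S = "(\<lambda>i. reflection l (simple_root i)) ` ({1..l} - {j})"
  interpret group "W l"
    by (rule W_group)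
  have gen: "h \<in> ?B" "inv\<^bsub>W l\<^esub> h = h" if "h \<in> ?S" for h
  proof -
    obtain i where "i \<in> {1..l} - {j}" "h = reflection l (simple_root i)"
      using \<open>h \<in> ?S\<close> by blast
    then have i: "i \<in> {1..l}" "i \<noteq> j" "h = coord_perm l (transpose i (Suc i))"
      by (auto simp: reflection_simple_root)
    have t: "transpose i (Suc i) permutes {1..l+1}"
      using i by (intro permutes_swap_id) auto
    moreover have "transpose i (Suc i) ` {1..j} \<subseteq> {1..j}"
      using i by (auto simp: transpose_def)
    ultimately show "h \<in> ?B"
      using i by blast
    have "h \<in> carrier (W l)"
      using simple_reflection_in_W \<open>h \<in> ?S\<close> by auto
    moreover have "h \<otimes>\<^bsub>W l\<^esub> h = \<one>\<^bsub>W l\<^esub>"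
      using W_mult[OF t t] by (simp add: i W_one)
    ultimately show "inv\<^bsub>W l\<^esub> h = h"
      by (simp add: inv_equality)
  qed
  fix w
  assume "w \<in> parabolic l j"
  then have "w \<in> generate (W l) ?S"
    by (simp add: parabolic_def)
  then show "w \<in> ?B"
  proof induction
    case one
    have "id permutes {1..l+1}" "id ` {1..j} \<subseteq> {1..j}"
      by (rule permutes_id) simp
    then show ?case
      unfolding W_one by blast
  next
    case (incl h)
    then show ?case
      by (rule gen)
  next
    case (inv h)
    show ?case
      unfolding gen(2)[OF inv] by (rule gen(1)[OF inv])
  next
    case (eng h1 h2)
    then obtain \<pi> \<rho> where \<pi>: "\<pi> permutes {1..l+1}" "\<pi> ` {1..j} \<subseteq> {1..j}" "h1 = coord_perm l \<pi>"
      and \<rho>: "\<rho> permutes {1..l+1}" "\<rho> ` {1..j} \<subseteq> {1..j}" "h2 = coord_perm l \<rho>"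
      by blast
    have "(\<pi> \<circ> \<rho>) ` {1..j} \<subseteq> {1..j}"
      using \<pi>(2) \<rho>(2) by (auto simp: image_subset_iff)
    then show ?case
      unfolding \<pi>(3) \<rho>(3) W_mult[OF \<pi>(1) \<rho>(1)] using permutes_compose[OF \<rho>(1) \<pi>(1)] by blast
  qed
next
  let ?S = "(\<lambda>i. reflection l (simple_root i)) ` ({1..l} - {j})"
  fix w
  assume "w \<in> ?B"
  then obtain \<pi> where \<pi>: "\<pi> permutes {1..l+1}" "\<pi> ` {1..j} \<subseteq> {1..j}" "w = coord_perm l \<pi>"
    by blast
  then obtain "is" where "is": "set is \<subseteq> {1..l} - {j}" "word_perm is = \<pi>"
    using reduced_word assms by blast
  have "foldr (\<lambda>i u. reflection l (simple_root i) \<otimes>\<^bsub>W l\<^esub> u) is \<one>\<^bsub>W l\<^esub> \<in> parabolic l j"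
    using "is"(1)
  proof (induction "is")
    case Nil
    show ?case
      by (simp add: parabolic_def generate.one)
  next
    case (Cons i "is")
    then have "reflection l (simple_root i) \<in> generate (W l) ?S"
      by (intro generate.incl imageI) simp
    with Cons show ?case
      by (simp add: parabolic_def generate.eng)
  qed
  moreover have "foldr (\<lambda>i u. reflection l (simple_root i) \<otimes>\<^bsub>W l\<^esub> u) is \<one>\<^bsub>W l\<^esub> = w"
    using "is" \<pi> by (subst word_eq_coord_perm) auto
  ultimately show "w \<in> parabolic l j"
    by simp
qed

definition reverse_blocks :: "nat \<Rightarrow> nat \<Rightarrow> nat \<Rightarrow> nat" where
  "reverse_blocks n j p =
     (if p \<in> {1..j} then j + 1 - p else if p \<in> {j+1..n} then n + j + 1 - p else p)"

lemma reverse_blocks_permutes: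
  assumes "j \<le> n"
  shows "reverse_blocks n j permutes {1..n}"
proof (rule bij_imp_permutes)
  show "bij_betw (reverse_blocks n j) {1..n} {1..n}"
    by (rule bij_betw_byWitness[where f' = "reverse_blocks n j"])
      (use assms in \<open>auto simp: reverse_blocks_def\<close>)
qed (use assms in \<open>auto simp: reverse_blocks_def\<close>)

lemma reverse_blocks_in_parabolic:
  assumes "j \<le> l"
  shows "coord_perm l (reverse_blocks (l+1) j) \<in> parabolic l j"
proof -
  have "reverse_blocks (l+1) j permutes {1..l+1}"
    using assms by (intro reverse_blocks_permutes) simp
  moreover have "reverse_blocks (l+1) j ` {1..j} \<subseteq> {1..j}"
    by (auto simp: reverse_blocks_def)
  ultimately show ?thesis
    unfolding parabolic_eq[OF assms] by blast
qed

lemma inversions_reverse_blocks: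
  assumes "j \<le> n"
  shows "inversions n (reverse_blocks n j) =
    {(a, b). a \<in> {1..n} \<and> b \<in> {1..n} \<and> a < b \<and> (a \<le> j \<longleftrightarrow> b \<le> j)}"
  using assms by (auto simp: inversions_def reverse_blocks_def)

lemma inversions_block_subset:
  assumes "\<pi> permutes {1..n}" "\<pi> ` {1..j} \<subseteq> {1..j}" "j \<le> n"
  shows "inversions n \<pi> \<subseteq> inversions n (reverse_blocks n j)"
proof -
  have block: "\<pi> ` {1..j} = {1..j}"
    using assms permutes_inj_on[OF assms(1)] by (intro endo_inj_surj) auto
  have low: "\<pi> a \<in> {1..j} \<longleftrightarrow> a \<in> {1..j}" for a
    using inj_image_mem_iff[OF permutes_inj[OF assms(1)], of a "{1..j}"] block by simp
  have "\<pi> a < \<pi> b" if "a \<in> {1..n}" "b \<in> {1..n}" "a \<le> j" "\<not> b \<le> j" for a b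
    using low[of a] low[of b] that permutes_in_image[OF assms(1), of b] by auto
  then show ?thesis
    unfolding inversions_reverse_blocks[OF assms(3)] by (fastforce simp: inversions_def)
qed

text \<open>A permutation preserving the two blocks never inverts a pair of indices from different
  blocks, and the blockwise reversal inverts all other pairs. So it has the most inversions, and
  any competitor with as many has the same inversions and is the same permutation.\<close>

lemma longest_eq:
  assumes "1 \<le> l" "j \<le> l"
  shows "longest l j = coord_perm l (reverse_blocks (l+1) j)"
proof -
  let ?r = "reverse_blocks (l+1) j"
  have r: "?r permutes {1..l+1}"
    using assms by (intro reverse_blocks_permutes) simp
  have mem: "coord_perm l ?r \<in> parabolic l j"
    using reverse_blocks_in_parabolic[OF assms(2)] .
  have sub: "inversions (l+1) \<pi> \<subseteq> inversions (l+1) ?r"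
    if "\<pi> permutes {1..l+1}" "\<pi> ` {1..j} \<subseteq> {1..j}" for \<pi>
    using inversions_block_subset[OF that] assms by simp
  show ?thesis
    unfolding longest_def
  proof (rule the_equality, intro conjI ballI mem)
    fix u
    assume "u \<in> parabolic l j"
    then obtain \<pi> where \<pi>: "\<pi> permutes {1..l+1}" "\<pi> ` {1..j} \<subseteq> {1..j}" "u = coord_perm l \<pi>"
      unfolding parabolic_eq[OF assms(2)] by blast
    show "weyl_length l u \<le> weyl_length l (coord_perm l ?r)"
      unfolding \<pi>(3) weyl_length_eq[OF assms(1) \<pi>(1)] weyl_length_eq[OF assms(1) r]
      using sub[OF \<pi>(1,2)] by (intro card_mono finite_inversions)
  next
    fix w
    assume w: "w \<in> parabolic l j \<and> (\<forall>u\<in>parabolic l j. weyl_length l u \<le> weyl_length l w)"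
    then obtain \<pi> where \<pi>: "\<pi> permutes {1..l+1}" "\<pi> ` {1..j} \<subseteq> {1..j}" "w = coord_perm l \<pi>"
      unfolding parabolic_eq[OF assms(2)] by blast
    have "card (inversions (l+1) ?r) \<le> card (inversions (l+1) \<pi>)"
      using w mem unfolding \<pi>(3) weyl_length_eq[OF assms(1) \<pi>(1), symmetric]
        weyl_length_eq[OF assms(1) r, symmetric] by blast
    then have "inversions (l+1) \<pi> = inversions (l+1) ?r"
      using sub[OF \<pi>(1,2)] by (intro card_seteq finite_inversions)
    then show "w = coord_perm l ?r"
      using inversions_inj[OF \<pi>(1) r] \<pi>(3) by simp
  qed
qed

section \<open>The element omega is a cyclic shift\<close>

text \<open>Cyclic shift by \<open>k\<close>; the positions are \<open>1, \<dots>, n\<close>, while residues start at \<open>0\<close>.\<close>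

definition shift :: "nat \<Rightarrow> nat \<Rightarrow> nat \<Rightarrow> nat" where
  "shift n k p = (if p \<in> {1..n} then Suc ((p - 1 + k) mod n) else p)"

lemma shift_in: "p \<in> {1..n} \<Longrightarrow> shift n k p \<in> {1..n}"
  by (auto simp: shift_def Suc_le_eq)

lemma shift_comp: "shift n a \<circ> shift n b = shift n (a + b)"
proof
  fix p
  show "(shift n a \<circ> shift n b) p = shift n (a + b) p"
  proof (cases "p \<in> {1..n}")
    case True
    then show ?thesis
      using shift_in[OF True, of b] by (simp add: shift_def mod_simps ac_simps)
  qed (auto simp: shift_def)
qed

lemma shift_eq_id_iff:
  assumes "1 \<le> n"
  shows "shift n k = id \<longleftrightarrow> n dvd k"
proof
  assume "shift n k = id"
  then have "shift n k 1 = 1"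
    by simp
  then show "n dvd k"
    using assms by (simp add: shift_def mod_eq_0_iff_dvd)
next
  assume "n dvd k"
  then have "(p - 1 + k) mod n = p - 1" if "p \<in> {1..n}" for p
    using that by (cases p) (auto elim!: dvdE)
  then show "shift n k = id"
    by (auto simp: shift_def fun_eq_iff)
qed

lemma shift_permutes:
  assumes "1 \<le> n"
  shows "shift n k permutes {1..n}"
proof (rule bij_imp_permutes)
  have "k * (n - 1) + k = n * k"
    using assms by (cases n) simp_all
  then have "shift n (k * (n - 1)) \<circ> shift n k = id" "shift n k \<circ> shift n (k * (n - 1)) = id"
    using assms by (simp_all only: shift_comp shift_eq_id_iff add.commute dvd_triv_left)
  then show "bij_betw (shift n k) {1..n} {1..n}"
    by (intro bij_betw_byWitness[where f' = "shift n (k * (n - 1))"])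
      (auto simp: fun_eq_iff simp del: One_nat_def atLeastAtMost_iff intro: shift_in)
qed (auto simp: shift_def)

text \<open>The full reversal sends \<open>p\<close> to \<open>n + 1 - p\<close>. Reversing the blocks then gives
  \<open>n + j + 1 - (n + 1 - p) = p + j\<close> in the upper block and \<open>j + 1 - (n + 1 - p) = p + j - n\<close> in
  the lower one.\<close>

lemma omega_eq:
  assumes "j \<in> {1..l}"
  shows "omega l j = coord_perm l (shift (l+1) j)"
proof -
  let ?n = "l + 1"
  have "reverse_blocks ?n j (reverse_blocks ?n 0 p) = shift ?n j p" for p
  proof (cases "p \<in> {1..?n}")
    case True
    have p: "reverse_blocks ?n 0 p = l + 2 - p"
      using True by (simp add: reverse_blocks_def)
    show ?thesis
    proof (cases "p - 1 + j < ?n")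
      case less: True
      then show ?thesis
        using True unfolding p by (auto simp: reverse_blocks_def shift_def)
    next
      case False
      then have "(p - 1 + j) mod ?n = p - 1 + j - ?n"
        using True assms by (subst le_mod_geq) auto
      then show ?thesis
        using False True assms unfolding p by (auto simp: reverse_blocks_def shift_def)
    qed
  qed (use assms in \<open>auto simp: reverse_blocks_def shift_def\<close>)
  then have "reverse_blocks ?n j \<circ> reverse_blocks ?n 0 = shift ?n j"
    by (simp add: fun_eq_iff)
  moreover have "reverse_blocks ?n j permutes {1..?n}" "reverse_blocks ?n 0 permutes {1..?n}"
    using assms by (intro reverse_blocks_permutes; simp)+
  ultimately show ?thesis
    using assms W_mult by (simp add: omega_def longest_eq)
qed

lemma omega_pow:
  assumes "j \<in> {1..l}"
  shows "omega l j [^]\<^bsub>W l\<^esub> (t::nat) = coord_perm l (shift (l+1) (j * t))"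
proof (induction t)
  case 0
  then show ?case
    using shift_eq_id_iff[of "l+1" 0] by (simp add: W_one id_def)
next
  case (Suc t)
  have "coord_perm l (shift (l+1) (j * t)) \<otimes>\<^bsub>W l\<^esub> coord_perm l (shift (l+1) j)
      = coord_perm l (shift (l+1) (j * Suc t))"
    using W_mult[OF shift_permutes shift_permutes] by (simp add: shift_comp add.commute)
  with Suc show ?case
    by (simp add: omega_eq[OF assms])
qed

lemma omega_in_W:
  assumes "j \<in> {1..l}"
  shows "omega l j \<in> carrier (W l)"
proof -
  interpret group "W l"
    by (rule W_group)
  have "longest l k \<in> carrier (W l)" if "k \<le> l" for k
  proof -
    have "coord_perm l (reverse_blocks (l+1) k) \<in> parabolic l k"
      using reverse_blocks_in_parabolic[OF that] .
    also have "\<dots> \<subseteq> carrier (W l)"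
      unfolding parabolic_def using simple_reflection_in_W by (intro generate_incl) auto
    finally show ?thesis
      using longest_eq assms that by simp
  qed
  then show ?thesis
    using assms by (simp add: omega_def)
qed

lemma dvd_mult_iff_div_gcd:
  fixes n j t :: nat
  assumes "n \<noteq> 0"
  shows "n dvd j * t \<longleftrightarrow> n div gcd n j dvd t"
proof -
  let ?g = "gcd n j"
  have "n dvd j * t \<longleftrightarrow> ?g * (n div ?g) dvd ?g * (j div ?g * t)"
    by (simp flip: mult.assoc)
  also have "\<dots> \<longleftrightarrow> n div ?g dvd j div ?g * t"
    using assms by (subst nat_mult_dvd_cancel_disj) simp
  also have "\<dots> \<longleftrightarrow> n div ?g dvd t"
    using div_gcd_coprime[of n j] assms by (simp add: coprime_dvd_mult_right_iff)
  finally show ?thesis .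
qed

lemma ord_omega:
  assumes "j \<in> {1..l}"
  shows "group.ord (W l) (omega l j) = (l + 1) div gcd (l + 1) j"
proof -
  interpret group "W l"
    by (rule W_group)
  have "omega l j [^]\<^bsub>W l\<^esub> t = \<one>\<^bsub>W l\<^esub> \<longleftrightarrow> (l + 1) div gcd (l + 1) j dvd t" for t :: nat
  proof -
    have "omega l j [^]\<^bsub>W l\<^esub> t = \<one>\<^bsub>W l\<^esub> \<longleftrightarrow> shift (l+1) (j * t) = id"
      unfolding omega_pow[OF assms] W_one
      using assms coord_perm_faithful[OF _ shift_permutes permutes_id] by auto
    also have "\<dots> \<longleftrightarrow> l + 1 dvd j * t"
      by (rule shift_eq_id_iff) simp
    also have "\<dots> \<longleftrightarrow> (l + 1) div gcd (l + 1) j dvd t"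
      by (rule dvd_mult_iff_div_gcd) simp
    finally show ?thesis .
  qed
  then show ?thesis
    using ord_unique[OF omega_in_W[OF assms]] by blast
qed

section \<open>Averages of roots\<close>

definition residue_class :: "nat \<Rightarrow> nat \<Rightarrow> nat \<Rightarrow> nat set" where
  "residue_class n g p = {r \<in> {1..n}. r mod g = p mod g}"

text \<open>Shifting by multiples of \<open>j\<close> preserves residues modulo \<open>gcd n j\<close>. Two multiples \<open>j s\<close> and
  \<open>j t\<close> agree modulo \<open>n\<close> only if \<open>s\<close> and \<open>t\<close> agree modulo \<open>n div gcd n j\<close>, and by Bezout every
  multiple of the gcd is a multiple of \<open>j\<close> modulo \<open>n\<close>.\<close>

lemma bij_betw_shift_residue_class:
  assumes "1 \<le> n" "1 \<le> j" "p \<in> {1..n}"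
  shows "bij_betw (\<lambda>t. shift n (j * t) p) {1..n div gcd n j} (residue_class n (gcd n j) p)"
proof -
  define g where "g = gcd n j"
  define m where "m = n div g"
  have "0 < g"
    using assms by (simp add: g_def)
  have n: "n = g * m"
    by (simp add: m_def g_def)
  then have "0 < m"
    using assms(1) by (cases m) auto
  have shift_p: "shift n k p = Suc ((p - 1 + k) mod n)" for k
    using assms(3) by (simp add: shift_def)
  have n_dvd: "n dvd j * t \<longleftrightarrow> m dvd t" for t
    using dvd_mult_iff_div_gcd[of n j t] assms(1) by (simp add: m_def g_def)
  have ne: "shift n (j * s) p \<noteq> shift n (j * t) p" if "s < t" "s \<in> {1..m}" "t \<in> {1..m}" for s t
  proof
    assume "shift n (j * s) p = shift n (j * t) p"
    then have "(p - 1 + j * t) mod n = (p - 1 + j * s) mod n"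
      by (simp add: shift_p)
    moreover have "p - 1 + j * s \<le> p - 1 + j * t"
      using that(1) by simp
    ultimately have "n dvd (p - 1 + j * t) - (p - 1 + j * s)"
      using mod_eq_dvd_iff_nat by blast
    then have "n dvd j * (t - s)"
      by (simp add: diff_mult_distrib2)
    then have "m dvd t - s"
      by (simp add: n_dvd)
    then show False
      using that by (auto dest: dvd_imp_le)
  qed
  have "inj_on (\<lambda>t. shift n (j * t) p) {1..m}"
    by (rule linorder_inj_onI) (use ne in auto)
  moreover have "(\<lambda>t. shift n (j * t) p) ` {1..m} = residue_class n g p"
  proof (intro equalityI subsetI)
    fix r
    assume "r \<in> (\<lambda>t. shift n (j * t) p) ` {1..m}"
    then obtain t where r: "r = shift n (j * t) p"
      by blast
    have "g dvd n" "g dvd j * t"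
      by (simp_all add: g_def)
    then have "((p - 1 + j * t) mod n) mod g = (p - 1) mod g"
      by (auto simp: mod_mod_cancel elim!: dvdE)
    then have "Suc ((p - 1 + j * t) mod n) mod g = Suc (p - 1) mod g"
      by (metis mod_Suc_eq)
    then show "r \<in> residue_class n g p"
      using assms(3) shift_in[OF assms(3), of "j * t"] by (simp add: residue_class_def r shift_p)
  next
    fix r
    assume "r \<in> residue_class n g p"
    then have r: "r \<in> {1..n}" "r mod g = p mod g"
      by (auto simp: residue_class_def)
    have "(r + n) mod g = p mod g"
      using r(2) by (simp add: n)
    moreover have "p \<le> r + n"
      using assms(3) by simp
    ultimately have "g dvd r + n - p"
      using mod_eq_dvd_iff_nat by blast
    then obtain c where c: "r + n - p = g * c"
      by blast
    obtain x y where xy: "j * x = n * y + gcd j n"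
      using bezout_nat[of j n] assms(2) by auto
    \<comment> \<open>The summand \<open>m\<close> makes the solution positive and does not change \<open>j * x'\<close> modulo \<open>n\<close>,
      so that \<open>x' - 1\<close> may be reduced modulo \<open>m\<close>.\<close>
    define x' where "x' = x * c + m"
    define t where "t = Suc ((x' - 1) mod m)"
    have "t \<in> {1..m}"
      using \<open>0 < m\<close> by (simp add: t_def Suc_le_eq)
    have "x' = t + m * ((x' - 1) div m)"
      using \<open>0 < m\<close> mod_mult_div_eq[of "x' - 1" m] by (simp add: t_def x'_def)
    then have "j * x' = j * t + (j * m) * ((x' - 1) div m)"
      by (metis distrib_left mult.assoc)
    moreover have "n dvd j * m"
      by (simp add: n_dvd)
    ultimately obtain z where "j * x' = j * t + n * z"
      by (metis dvdE mult.assoc)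
    then have "(p - 1 + j * t) mod n = (p - 1 + j * x') mod n"
      by (simp flip: add.assoc)
    also have "j * x' = n * y * c + g * c + j * m"
      using xy by (simp add: x'_def algebra_simps g_def gcd.commute)
    also have "p - 1 + (n * y * c + g * c + j * m) = (r - 1) + n + n * y * c + j * m"
      using c[symmetric] assms(3) r(1) by simp
    also have "\<dots> mod n = (r - 1) mod n"
      using \<open>n dvd j * m\<close> by (auto elim!: dvdE simp: mult.assoc)
    also have "(r - 1) mod n = r - 1"
      using r(1) by (intro mod_less) auto
    finally have "shift n (j * t) p = r"
      using r(1) by (simp add: shift_p)
    then show "r \<in> (\<lambda>t. shift n (j * t) p) ` {1..m}"
      using \<open>t \<in> {1..m}\<close> by blast
  qed
  ultimately show ?thesis
    by (simp add: bij_betw_def g_def m_def)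
qed

lemma average_root:
  assumes "j \<in> {1..l}" "p \<in> {1..l+1}" "q \<in> {1..l+1}"
  shows "average l (omega l j) (e p - e q) = (1 / real ((l + 1) div gcd (l + 1) j)) *\<^sub>R
    ((\<Sum>r\<in>residue_class (l+1) (gcd (l+1) j) p. e r) - (\<Sum>r\<in>residue_class (l+1) (gcd (l+1) j) q. e r))"
proof -
  let ?n = "l + 1" and ?g = "gcd (l + 1) j"
  have sum_orbit: "(\<Sum>t=1..?n div ?g. e (shift ?n (j * t) r)) = (\<Sum>r\<in>residue_class ?n ?g r. e r)"
    if "r \<in> {1..?n}" for r
    using assms(1) that by (intro sum.reindex_bij_betw bij_betw_shift_residue_class) auto
  have "(omega l j [^]\<^bsub>W l\<^esub> t) (e p - e q) = e (shift ?n (j * t) p) - e (shift ?n (j * t) q)" for t :: nat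
    unfolding omega_pow[OF assms(1)] by (rule coord_perm_root[OF shift_permutes assms(2,3)]) simp
  then show ?thesis
    unfolding average_def ord_omega[OF assms(1)]
    by (simp only: sum_subtractf sum_orbit assms(2,3))
qed

text \<open>Distinct residue classes are disjoint, so their indicator vectors are separated by the
  coordinate at \<open>p\<close>.\<close>

lemma average_root_eq_0_iff:
  assumes "j \<in> {1..l}" "p \<in> {1..l+1}" "q \<in> {1..l+1}"
  shows "average l (omega l j) (e p - e q) = 0 \<longleftrightarrow> p mod gcd (l+1) j = q mod gcd (l+1) j"
proof
  let ?n = "l + 1" and ?g = "gcd (l + 1) j"
  let ?c = "\<lambda>p. \<Sum>r\<in>residue_class ?n ?g p. e r"
  have coeff: "Poly_Mapping.lookup (?c r) p = (if p mod ?g = r mod ?g then 1 else 0)" for r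
    using assms(2) by (simp add: lookup_simps residue_class_def)
  have "?n div ?g \<noteq> 0"
    by (simp add: div_eq_0_iff not_less)
  moreover assume "average l (omega l j) (e p - e q) = 0"
  ultimately have "?c p = ?c q"
    unfolding average_root[OF assms] by simp
  then have "Poly_Mapping.lookup (?c p) p = Poly_Mapping.lookup (?c q) p"
    by simp
  then show "p mod ?g = q mod ?g"
    unfolding coeff by (simp split: if_splits)
next
  assume "p mod gcd (l+1) j = q mod gcd (l+1) j"
  then show "average l (omega l j) (e p - e q) = 0"
    by (simp add: average_root[OF assms] residue_class_def)
qed

section \<open>Pairing with the sum of the coweights in the orbit of the affine node\<close>

lemma sigma_funpow:
  "(sigma l j ^^ t) 0 = (j * t) mod (l + 1)"
proof (induction t)
  case (Suc t)
  have step: "sigma l j s = (j + s) mod (l + 1)" if "s \<le> l" for s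
  proof -
    have "map (sigma l j) [0..<l+1] ! s = rotate j [0..<l+1] ! s"
      unfolding sigma_def by (subst cyclic_rotation) simp_all
    then show ?thesis
      using that by (simp add: nth_rotate del: upt_Suc)
  qed
  show ?case
    using Suc by (simp add: step mod_simps del: upt_Suc)
qed simp

text \<open>The orbit of \<open>0\<close> under adding \<open>j\<close> modulo \<open>l + 1\<close> is the residue class of \<open>1\<close>, moved down
  by one.\<close>

lemma orbit_sigma:
  assumes "j \<in> {1..l}"
  shows "orbit (sigma l j) 0 = {s \<in> {0..l}. gcd (l+1) j dvd s}"
proof (intro equalityI subsetI)
  fix s
  assume "s \<in> orbit (sigma l j) 0"
  then obtain t where s: "s = (j * t) mod (l + 1)"
    by (auto simp: orbit_altdef sigma_funpow)
  have "gcd (l+1) j dvd (j * t) mod (l + 1)"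
    by (rule dvd_mod) auto
  then show "s \<in> {s \<in> {0..l}. gcd (l+1) j dvd s}"
    using s by (simp add: less_Suc_eq_le[symmetric])
next
  fix s
  assume s: "s \<in> {s \<in> {0..l}. gcd (l+1) j dvd s}"
  then have "Suc s mod gcd (l+1) j = 1 mod gcd (l+1) j"
    by (auto elim!: dvdE simp: mod_Suc)
  with s have "Suc s \<in> residue_class (l+1) (gcd (l+1) j) 1"
    by (simp add: residue_class_def)
  then obtain t where "t \<in> {1..(l+1) div gcd (l+1) j}" "Suc s = shift (l+1) (j * t) 1"
    using bij_betw_shift_residue_class[of "l+1" j 1] assms unfolding bij_betw_def by fastforce
  then have "0 < t" "s = (sigma l j ^^ t) 0"
    by (simp_all add: shift_def sigma_funpow)
  then show "s \<in> orbit (sigma l j) 0"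
    by (auto simp: orbit_altdef)
qed

text \<open>Dividing by \<open>g\<close> turns the multiples in question into \<open>m\<close> consecutive numbers, starting at
  the rounded-up quotient \<open>c\<close> of \<open>p\<close> by \<open>g\<close>.\<close>

lemma card_multiples_interval:
  fixes g p m :: nat
  assumes "0 < g"
  shows "card {s \<in> {p..<p + g * m}. g dvd s} = m"
proof -
  define c where "c = (p + g - 1) div g"
  have ge: "p \<le> g * k \<longleftrightarrow> c \<le> k" for k
  proof -
    have "c \<le> k \<longleftrightarrow> \<not> Suc k \<le> (p + g - 1) div g"
      by (auto simp: c_def)
    also have "\<dots> \<longleftrightarrow> \<not> Suc k * g \<le> p + g - 1"
      by (simp only: less_eq_div_iff_mult_less_eq[OF assms])
    also have "\<dots> \<longleftrightarrow> p \<le> g * k"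
      using assms by (auto simp: mult.commute)
    finally show ?thesis
      by simp
  qed
  have lt: "g * k < p + g * m \<longleftrightarrow> k < c + m" for k
  proof (cases "k < m")
    case False
    then obtain i where "k = m + i"
      by (metis le_Suc_ex not_less)
    then show ?thesis
      using ge[of i] by (simp add: algebra_simps linorder_not_le[symmetric])
  next
    case True
    then have "g * k < g * m"
      using assms by simp
    then show ?thesis
      using True by linarith
  qed
  have "{s \<in> {p..<p + g * m}. g dvd s} = (\<lambda>k. g * k) ` {c..<c + m}"
    by (auto simp: ge lt elim!: dvdE)
  moreover have "inj_on (\<lambda>k. g * k) {c..<c + m}"
    using assms by (simp add: inj_on_def)
  ultimately show ?thesis
    by (simp add: card_image)
qed

lemma ip_root_pi0:
  assumes "j \<in> {1..l}" "p \<in> {1..l+1}" "p + gcd (l+1) j * m \<in> {1..l+1}" "0 < m"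
  shows "ip (e p - e (p + gcd (l+1) j * m)) (pi0 l j) = real m"
proof -
  let ?g = "gcd (l + 1) j"
  let ?q = "p + ?g * m"
  let ?O = "{s \<in> {0..l}. ?g dvd s}"
  have "p < ?q"
    using assms by simp
  then have "ip (e p - e ?q) (pi0 l j) = (\<Sum>s\<in>?O. ip (e p - e ?q) (coweight l s))"
    by (simp add: pi0_def orbit_sigma[OF assms(1)] ip_root_left lookup_sum sum_subtractf)
  also have "\<dots> = (\<Sum>s\<in>?O. if s \<in> {p..<?q} then 1 else 0)"
    using ip_root_coweight[OF assms(2,3) \<open>p < ?q\<close>] by (intro sum.cong) auto
  also have "\<dots> = real (card (?O \<inter> {p..<?q}))"
    using sum.inter_restrict[of ?O "\<lambda>_. 1 :: real" "{p..<?q}"] by simp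
  also have "?O \<inter> {p..<?q} = {s \<in> {p..<?q}. ?g dvd s}"
    using assms(3) by auto
  also have "card \<dots> = m"
    using assms(1) by (intro card_multiples_interval) simp
  finally show ?thesis .
qed

lemma positive_multiple_iff:
  fixes p q g :: nat
  assumes "0 < g"
  shows "int q - int p \<in> {int g * m | m. 0 < m} \<longleftrightarrow> p < q \<and> p mod g = q mod g"
proof
  assume "int q - int p \<in> {int g * m | m. 0 < m}"
  then obtain m where m: "int q - int p = int g * m" "0 < m"
    by blast
  then have "int q = int (p + g * nat m)"
    by simp
  then have "q = p + g * nat m"
    using of_nat_eq_iff by blast
  then show "p < q \<and> p mod g = q mod g"
    using m(2) assms by simp
next
  assume "p < q \<and> p mod g = q mod g"
  then have "p < q" "g dvd q - p"
    using mod_eq_dvd_iff_nat[of p q g] by auto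
  then obtain m where "q - p = g * m"
    by blast
  then have "q = p + g * m" "0 < m"
    using \<open>p < q\<close> by (auto intro: Nat.gr0I)
  then show "int q - int p \<in> {int g * m | m. 0 < m}"
    by (intro CollectI exI[of _ "int m"]) simp
qed

text \<open>The roots of average zero are \<open>\<plusminus>(e p - e (p + g k))\<close> with \<open>k > 0\<close>, which pair to \<open>\<plusminus>k\<close>.
  Fitting into \<open>{1..l+1}\<close> forces \<open>g k < l + 1\<close>, and \<open>p = 1\<close> realises every such \<open>k\<close>.\<close>

lemma P_0_eq:
  assumes "j \<in> {1..l}"
  shows "P l j 0 = {real k | k. k \<in> {1..(l+1) div gcd (l+1) j - 1}}
               \<union> {- real k | k. k \<in> {1..(l+1) div gcd (l+1) j - 1}}"
proof -
  define g where "g = gcd (l + 1) j"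
  define m where "m = (l + 1) div g"
  have "0 < g"
    using assms by (simp add: g_def)
  have n: "l + 1 = g * m"
    unfolding m_def g_def by simp
  have bound: "k \<in> {1..m - 1}" if "p + g * k \<in> {1..l+1}" "p \<in> {1..l+1}" "0 < k" for p k
  proof -
    have "g * k < g * m"
      using that unfolding n atLeastAtMost_iff by linarith
    then show ?thesis
      using that(3) \<open>0 < g\<close> by auto
  qed
  have pos: "ip (e p - e (p + g * k)) (pi0 l j) = real k"
    if "p + g * k \<in> {1..l+1}" "p \<in> {1..l+1}" "0 < k" for p k
    using ip_root_pi0[OF assms] that by (simp add: g_def)
  have neg: "ip (e q - e p) w = - ip (e p - e q) w" if "p \<noteq> q" for p q w
    using that by (simp add: ip_root_left)
  have split: "\<exists>k>0. q = p + g * k" if "p < q" "p mod g = q mod g" for p q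
  proof -
    have "g dvd q - p"
      using that mod_eq_dvd_iff_nat[of p q g] by simp
    then obtain k where "q - p = g * k"
      by blast
    with \<open>p < q\<close> show ?thesis
      by (intro exI[of _ k]) (auto intro: Nat.gr0I)
  qed
  let ?R = "{real k | k. k \<in> {1..m - 1}} \<union> {- real k | k. k \<in> {1..m - 1}}"
  have "P l j 0 = ?R"
  proof (intro equalityI subsetI)
    fix x
    assume "x \<in> P l j 0"
    then obtain p q where pq: "p \<in> {1..l+1}" "q \<in> {1..l+1}" "p \<noteq> q"
        "x = ip (e p - e q) (pi0 l j)" "average l (omega l j) (e p - e q) = 0"
      unfolding P_def roots_def by blast
    then have "p mod g = q mod g"
      using average_root_eq_0_iff[OF assms] by (simp add: g_def)
    show "x \<in> ?R"
    proof (cases "p < q")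
      case True
      then obtain k where k: "0 < k" "q = p + g * k"
        using split \<open>p mod g = q mod g\<close> by blast
      then have "x = real k" "k \<in> {1..m - 1}"
        using pos[of p k] bound[of p k] pq by simp_all
      then show ?thesis
        by blast
    next
      case False
      then obtain k where k: "0 < k" "p = q + g * k"
        using split[of q p] \<open>p mod g = q mod g\<close> \<open>p \<noteq> q\<close> by auto
      then have "x = - real k" "k \<in> {1..m - 1}"
        using pos[of q k] bound[of q k] neg[of q p] pq by simp_all
      then show ?thesis
        by blast
    qed
  next
    fix x
    assume "x \<in> ?R"
    then obtain k where k: "k \<in> {1..m - 1}" "x = real k \<or> x = - real k"
      by blast
    have "g * k < l + 1"
      unfolding n using k(1) \<open>0 < g\<close> by auto
    then have p: "1 \<in> {1..l+1}" "1 + g * k \<in> {1..l+1}" "1 \<noteq> 1 + g * k" "0 < k"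
      using k(1) \<open>0 < g\<close> by auto
    have avg: "average l (omega l j) (e 1 - e (1 + g * k)) = 0"
      unfolding average_root_eq_0_iff[OF assms p(1,2), folded g_def]
      by (rule mod_mult_self2[symmetric])
    have avg': "average l (omega l j) (e (1 + g * k) - e 1) = 0"
      unfolding average_root_eq_0_iff[OF assms p(2,1), folded g_def]
      by (rule mod_mult_self2)
    have "e 1 - e (1 + g * k) \<in> roots l" "e (1 + g * k) - e 1 \<in> roots l"
      unfolding roots_def using p p(3)[symmetric] by blast+
    then have "ip (e 1 - e (1 + g * k)) (pi0 l j) \<in> P l j 0"
      "ip (e (1 + g * k) - e 1) (pi0 l j) \<in> P l j 0"
      unfolding P_def using avg avg' by blast+
    then show "x \<in> P l j 0"
      using k(2) pos[OF p(2,1,4)] neg[OF p(3)] by auto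
  qed
  then show ?thesis
    by (simp add: m_def g_def)
qed

theorem proposition5p2:
  fixes l j g :: nat and \<omega> :: "vec \<Rightarrow> vec"
  assumes "j \<in> J l - {0}"
    and "\<omega> = omega l j"
    and "g = gcd (l + 1) j"
  shows "J l - {0} = {1..l}
    \<and> {\<beta> \<in> pos_roots l. average l \<omega> \<beta> = 0}
        = {e p1 - e p2 | p1 p2. p1 \<in> {1..l+1} \<and> p2 \<in> {1..l+1} \<and>
             int p2 - int p1 \<in> {int g * m | m. 0 < m}}
    \<and> {e p1 - e p2 | p1 p2. p1 \<in> {1..l+1} \<and> p2 \<in> {1..l+1} \<and>
             int p2 - int p1 \<in> {int g * m | m. 0 < m}}
        = {\<Sum>i=i1..i2. simple_root i | i1 i2. i1 \<in> {1..l} \<and> i2 \<in> {1..l} \<and>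
             int i2 - int i1 + 1 \<in> {int g * m | m. 0 < m}}
    \<and> P l j 0 = {real k | k. k \<in> {1..group.ord (W l) \<omega> - 1}}
               \<union> {- real k | k. k \<in> {1..group.ord (W l) \<omega> - 1}}"
proof (intro conjI)
  have j: "j \<in> {1..l}"
    using assms(1) by (auto simp: J_eq)
  have "0 < g"
    using assms(3) by simp
  note iff = positive_multiple_iff[OF \<open>0 < g\<close>]
  show "J l - {0} = {1..l}"
    by (auto simp: J_eq)
  show "{\<beta> \<in> pos_roots l. average l \<omega> \<beta> = 0}
        = {e p1 - e p2 | p1 p2. p1 \<in> {1..l+1} \<and> p2 \<in> {1..l+1} \<and>
             int p2 - int p1 \<in> {int g * m | m. 0 < m}}"
    unfolding iff pos_roots_def assms(2)
    using average_root_eq_0_iff[OF j, folded assms(3)] by blast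
  show "{e p1 - e p2 | p1 p2. p1 \<in> {1..l+1} \<and> p2 \<in> {1..l+1} \<and>
             int p2 - int p1 \<in> {int g * m | m. 0 < m}}
        = {\<Sum>i=i1..i2. simple_root i | i1 i2. i1 \<in> {1..l} \<and> i2 \<in> {1..l} \<and>
             int i2 - int i1 + 1 \<in> {int g * m | m. 0 < m}}" (is "?L = ?R")
  proof -
    have shifted: "int i2 - int i1 + 1 = int (Suc i2) - int i1" for i1 i2
      by simp
    have "?R = {\<Sum>i=i1..i2. simple_root i | i1 i2. i1 \<in> {1..l} \<and> i2 \<in> {1..l} \<and>
             i1 < Suc i2 \<and> i1 mod g = Suc i2 mod g}"
      unfolding shifted iff ..
    also have "\<dots> = {e i1 - e (Suc i2) | i1 i2. i1 \<in> {1..l} \<and> i2 \<in> {1..l} \<and>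
             i1 < Suc i2 \<and> i1 mod g = Suc i2 mod g}"
      by (intro Collect_cong ex_cong1) (auto simp: sum_simple_root)
    also have "\<dots> = {e p1 - e p2 | p1 p2. p1 \<in> {1..l+1} \<and> p2 \<in> {1..l+1} \<and>
             p1 < p2 \<and> p1 mod g = p2 mod g}"
    proof (intro equalityI subsetI)
      fix v
      assume "v \<in> {e p1 - e p2 | p1 p2. p1 \<in> {1..l+1} \<and> p2 \<in> {1..l+1} \<and>
             p1 < p2 \<and> p1 mod g = p2 mod g}"
      then obtain p1 p2 where p: "p1 \<in> {1..l+1}" "p2 \<in> {1..l+1}" "p1 < p2"
          "p1 mod g = p2 mod g" "v = e p1 - e p2"
        by blast
      then obtain i2 where "p2 = Suc i2"
        by (cases p2) auto
      with p show "v \<in> {e i1 - e (Suc i2) | i1 i2. i1 \<in> {1..l} \<and> i2 \<in> {1..l} \<and>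
             i1 < Suc i2 \<and> i1 mod g = Suc i2 mod g}"
        by fastforce
    qed fastforce
    also have "\<dots> = ?L"
      unfolding iff ..
    finally show ?thesis
      by simp
  qed
  show "P l j 0 = {real k | k. k \<in> {1..group.ord (W l) \<omega> - 1}}
               \<union> {- real k | k. k \<in> {1..group.ord (W l) \<omega> - 1}}"
    unfolding assms(2) ord_omega[OF j] by (rule P_0_eq[OF j])
qed

end
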